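(* Let parameters $L_f>\mu_f>0$, $\kappa_A\ge1$, $D>0$ be given and put $\kappa_f=L_f/\mu_f$, $N=\left\lfloor\frac{\kappa_A+1}2\right\rfloor$. For any integer $k\ge N$ with $k\ge2$, let $K=\left\lfloor\frac{k-2}{N+1}\right\rfloor+1$ and $d=2K$. Then, for a suitable $\alpha>0$, the problem $$\min_{x\in\mathbb{R}^{2Nd}}f_0(x)=\sum_{i=1}^NG(x[i],x[N+i])\quad\text{s.t. }x[1]=x[2]=\cdots=x[2N],$$ $$G(u,v)=\frac{L_f-\mu_f}4\left[(\alpha-u_1)^2+\sum_{i=1}^{d-1}(v_i-u_{i+1})^2\right]+\frac{\mu_f}2\left(\|u\|^2+\|v\|^2\right),$$ belongs to the class $\mathcal F_{\mathrm{SC}}(L_f,\mu_f,\kappa_A,D)$, and for this problem the $k$-th iterate generated by any first-order linear span algorithm (with $x_0=0$) satisfies $$\|x_k-x^\star\|\ge\frac12\left(\frac{\sqrt{\kappa_f}-1}{\sqrt{\kappa_f}+1}\right)^{\frac{2k}N}\|x_0-x^\star\| .$$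
   Context: Here $x\in\mathbb{R}^{2Nd}$ is the stack of vectors $x[1],\dots,x[2N]\in\mathbb{R}^d$. The constraint is written as $Ax=0$ (i.e. $b=0$) with $A\in\mathbb{R}^{(2N-1)d\times2Nd}$ the block matrix whose $i$-th block row gives $x[i]-x[i+1]$, $1\le i\le2N-1$. $x^\star$ is the optimal solution. Class $\mathcal F_{\mathrm{SC}}(L_f,\mu_f,\kappa_A,D)$: problems $\min_xf(x)+h(Ax-b)$ ($h$ proper closed convex; linear equality constraints $Ax=b$ correspond to $h=\mathbb I_{\{0\}}$, the indicator function of $\{0\}$) with $f$ $L_f$-smooth and $\mu_f$-strongly convex, $\|x_0-x^\star\|\le D$, and condition number of $A$ (norm over minimal singular value) at most $\kappa_A$. First-order linear span algorithm (class $\mathcal A$) for $\min f(x)$ s.t. $Ax=b$, with $x_0=0$ (and zero initial dual variable): the iterates satisfy $x_k\in\mathcal S^x_k$ for all $k$, where $\mathcal S^x_0=\mathrm{Span}\{x_0\}$ and $$\mathcal S^x_{k+1}=\mathrm{Span}\left\{x_i,\ \nabla f(\hat x_i),\ A^{\mathrm T}(A\hat x_i-b):\ \hat x_i\in\mathcal S^x_i,\ 0\le i\le k\right\}.$$ *)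

theory Defs
  imports "HOL-Analysis.Analysis"
begin

definition grad :: "('a::euclidean_space \<Rightarrow> real) \<Rightarrow> 'a \<Rightarrow> 'a" where
  "grad f x = (THE g. GDERIV f x :> g)"

definition smooth :: "real \<Rightarrow> ('a::euclidean_space \<Rightarrow> real) \<Rightarrow> bool" where
  "smooth L f \<longleftrightarrow> (\<forall>x. GDERIV f x :> grad f x) \<and> L-lipschitz_on UNIV (grad f)"

definition strongly_convex :: "real \<Rightarrow> ('a::euclidean_space \<Rightarrow> real) \<Rightarrow> bool" where
  "strongly_convex mu f \<longleftrightarrow>
     (\<forall>x y. \<forall>t\<in>{0..1}. f (t *\<^sub>R x + (1 - t) *\<^sub>R y)
        \<le> t * f x + (1 - t) * f y - mu / 2 * t * (1 - t) * (norm (x - y))\<^sup>2)"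

definition ereal_epigraph :: "('a \<Rightarrow> ereal) \<Rightarrow> ('a \<times> real) set" where
  "ereal_epigraph h = {(x, t). h x \<le> ereal t}"

definition proper_closed_convex :: "('a::euclidean_space \<Rightarrow> ereal) \<Rightarrow> bool" where
  "proper_closed_convex h \<longleftrightarrow>
     (\<exists>x. h x < \<infinity>) \<and> (\<forall>x. - \<infinity> < h x) \<and>
     closed (ereal_epigraph h) \<and> convex (ereal_epigraph h)"

definition indicator_zero :: "'a::zero \<Rightarrow> ereal" where
  "indicator_zero z = (if z = 0 then 0 else \<infinity>)"

text \<open>An \<open>m\<close> by \<open>n\<close> matrix has \<open>min m n\<close> singular values, so the smaller of the two
  Gram matrices is used.\<close>

definition singular_values :: "real^'n^'m \<Rightarrow> real set" where
  "singular_values A = {s. 0 \<le> s \<and>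
     (if CARD('m) \<le> CARD('n)
      then \<exists>v. v \<noteq> 0 \<and> (A ** transpose A) *v v = s\<^sup>2 *\<^sub>R v
      else \<exists>v. v \<noteq> 0 \<and> (transpose A ** A) *v v = s\<^sup>2 *\<^sub>R v)}"

text \<open>The infimum is a minimum, since the set is finite and nonempty.\<close>

definition min_singular_value :: "real^'n^'m \<Rightarrow> real" where
  "min_singular_value A = Inf (singular_values A)"

definition condition_number :: "real^'n^'m \<Rightarrow> real" where
  "condition_number A = onorm ((*v) A) / min_singular_value A"

definition optimal_solution ::
    "(real^'n \<Rightarrow> real) \<Rightarrow> (real^'m \<Rightarrow> ereal) \<Rightarrow> real^'n^'m \<Rightarrow> real^'m \<Rightarrow> real^'n \<Rightarrow> bool" where
  "optimal_solution f h A b x \<longleftrightarrow>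
     ereal (f x) + h (A *v x - b) < \<infinity> \<and>
     (\<forall>y. ereal (f x) + h (A *v x - b) \<le> ereal (f y) + h (A *v y - b))"

text \<open>Positivity of the minimal singular value is stated separately, because division by
  zero would give a rank-deficient matrix the condition number \<open>0\<close> instead of infinity.\<close>

definition in_F_SC ::
    "real \<Rightarrow> real \<Rightarrow> real \<Rightarrow> real \<Rightarrow> (real^'n \<Rightarrow> real) \<Rightarrow> (real^'m \<Rightarrow> ereal) \<Rightarrow>
     real^'n^'m \<Rightarrow> real^'m \<Rightarrow> real^'n \<Rightarrow> bool" where
  "in_F_SC L mu kA D f h A b x0 \<longleftrightarrow>
     smooth L f \<and> strongly_convex mu f \<and> proper_closed_convex h \<and>
     (\<exists>!xs. optimal_solution f h A b xs) \<and>
     (\<forall>xs. optimal_solution f h A b xs \<longrightarrow> norm (x0 - xs) \<le> D) \<and>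
     0 < min_singular_value A \<and> condition_number A \<le> kA"

fun span_space ::
    "(real^'n \<Rightarrow> real) \<Rightarrow> real^'n^'m \<Rightarrow> real^'m \<Rightarrow> (nat \<Rightarrow> real^'n) \<Rightarrow> nat \<Rightarrow> (real^'n) set" where
  "span_space f A b X 0 = span {X 0}"
| "span_space f A b X (Suc k) = span (\<Union>i\<in>{..k}.
     {X i} \<union> {grad f y | y. y \<in> span_space f A b X i}
           \<union> {transpose A *v (A *v y - b) | y. y \<in> span_space f A b X i})"

definition linear_span_iterates ::
    "(real^'n \<Rightarrow> real) \<Rightarrow> real^'n^'m \<Rightarrow> real^'m \<Rightarrow> (nat \<Rightarrow> real^'n) \<Rightarrow> bool" where
  "linear_span_iterates f A b X \<longleftrightarrow> X 0 = 0 \<and> (\<forall>k. X k \<in> span_space f A b X k)"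

text \<open>A stack of \<open>n\<close> vectors in \<open>d\<close>-dimensional space is a vector indexed by the pairs of
  a block index in \<open>'b\<close> and a coordinate index in \<open>'d\<close>. The maps \<open>blk\<close>, \<open>brow\<close> and \<open>co\<close>
  number the blocks, the block rows and the coordinates, starting from 1.\<close>

definition block :: "(nat \<Rightarrow> 'b) \<Rightarrow> real^('b::finite \<times> 'd::finite) \<Rightarrow> nat \<Rightarrow> real^'d" where
  "block blk x i = (\<chi> c. x $ (blk i, c))"

definition consensus_matrix ::
    "nat \<Rightarrow> (nat \<Rightarrow> 'b) \<Rightarrow> (nat \<Rightarrow> 'r) \<Rightarrow>
     real^('b::finite \<times> 'd::finite)^('r::finite \<times> 'd)" where
  "consensus_matrix n blk brow = (\<chi> p q.
     if snd p = snd q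
     then \<Sum>i = 1..n - 1. if fst p = brow i
            then of_bool (fst q = blk i) - of_bool (fst q = blk (i + 1)) else 0
     else 0)"

lemma consensus_matrix_block_row:
  fixes x :: "real^('b::finite \<times> 'd::finite)" and brow :: "nat \<Rightarrow> 'r::finite"
  assumes "bij_betw brow {1..n - 1} UNIV" "i \<in> {1..n - 1}"
  shows "block brow (consensus_matrix n blk brow *v x) i = block blk x i - block blk x (i + 1)"
proof -
  have inj: "brow i = brow j \<longleftrightarrow> i = j" if "j \<in> {1..n - 1}" for j
    using assms that by (auto simp: bij_betw_def inj_on_def)
  have S: "(\<Sum>j = 1..n - 1. if brow i = brow j then h j else 0) = h i" for h :: "nat \<Rightarrow> real"
  proof -
    have "(\<Sum>j = 1..n - 1. if brow i = brow j then h j else 0) = (\<Sum>j = 1..n - 1. if i = j then h j else 0)"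
      by (intro sum.cong) (use inj in auto)
    also have "\<dots> = h i" using assms(2) by simp
    finally show ?thesis .
  qed
  have "(consensus_matrix n blk brow *v x) $ (brow i, c) = x $ (blk i, c) - x $ (blk (i + 1), c)" for c
  proof -
    let ?h = "\<lambda>b. of_bool (b = blk i) - of_bool (b = blk (i + 1)) :: real"
    have "(consensus_matrix n blk brow *v x) $ (brow i, c)
        = (\<Sum>q\<in>UNIV \<times> UNIV. (if c = snd q then ?h (fst q) else 0) * x $ q)"
      by (simp add: matrix_vector_mult_def consensus_matrix_def S[simplified] cong: if_cong)
    also have "\<dots> = (\<Sum>b\<in>UNIV. \<Sum>e\<in>UNIV. (if c = e then ?h b else 0) * x $ (b, e))"
      unfolding sum.cartesian_product by (intro sum.cong) auto
    also have "\<dots> = (\<Sum>b\<in>UNIV. ?h b * x $ (b, c))"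
      by (simp add: if_distrib[of "\<lambda>z. z * _"] cong: if_cong)
    also have "\<dots> = (\<Sum>b\<in>UNIV. (if b = blk i then x $ (b, c) else 0)
        - (if b = blk (i + 1) then x $ (b, c) else 0))"
      by (intro sum.cong) (auto simp: algebra_simps)
    also have "\<dots> = x $ (blk i, c) - x $ (blk (i + 1), c)"
      by (simp add: sum_subtractf)
    finally show ?thesis .
  qed
  then show ?thesis by (simp add: block_def vec_eq_iff)
qed

definition G ::
    "real \<Rightarrow> real \<Rightarrow> real \<Rightarrow> nat \<Rightarrow> (nat \<Rightarrow> 'd) \<Rightarrow> real^'d::finite \<Rightarrow> real^'d \<Rightarrow> real" where
  "G L mu alpha d co u v =
     (L - mu) / 4 * ((alpha - u $ co 1)\<^sup>2 + (\<Sum>i = 1..d - 1. (v $ co i - u $ co (i + 1))\<^sup>2))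
     + mu / 2 * ((norm u)\<^sup>2 + (norm v)\<^sup>2)"

definition f0 ::
    "real \<Rightarrow> real \<Rightarrow> real \<Rightarrow> nat \<Rightarrow> nat \<Rightarrow> (nat \<Rightarrow> 'b) \<Rightarrow> (nat \<Rightarrow> 'd) \<Rightarrow>
     real^('b::finite \<times> 'd::finite) \<Rightarrow> real" where
  "f0 L mu alpha N d blk co x =
     (\<Sum>i = 1..N. G L mu alpha d co (block blk x i) (block blk x (N + i)))"

end

theory Submission
  imports Defs
begin

text \<open>The objective is a quadratic whose coupling vectors are pairwise orthogonal with squared
  length at most 2, which gives the smoothness constant. On the consensus subspace its optimality
  condition is the recurrence \<open>y (j + 1) = (q + 1 / q) y j - y (j - 1)\<close> with
  \<open>q = (sqrt \<kappa> - 1) / (sqrt \<kappa> + 1)\<close>, and the minimiser decays like \<open>q\<^sup>j\<close>. An algorithm needs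
  \<open>N\<close> multiplications by \<open>A\<^sup>T A\<close> to carry information about a coordinate from block 1 to block
  \<open>N + 1\<close>, and a gradient step to reach the next coordinate, so after \<open>k\<close> steps the coordinates
  beyond \<open>K\<close> in the last \<open>N\<close> blocks still vanish; at the minimiser they carry a fraction of at
  least \<open>q\<^sup>2\<^sup>K / 4\<close> of the squared norm, and \<open>K \<le> 2 k / N\<close>. The spectrum of \<open>A A\<^sup>T\<close> is
  that of the Dirichlet Laplacian of a path with \<open>2 N - 1\<close> nodes.\<close>

subsection \<open>Quadratic functions\<close>

definition quad :: "'i set \<Rightarrow> ('i \<Rightarrow> 'a::euclidean_space) \<Rightarrow> ('i \<Rightarrow> real) \<Rightarrow> real \<Rightarrow> real \<Rightarrow> 'a \<Rightarrow> real" where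
  "quad I a \<beta> w \<mu> x = w / 2 * (\<Sum>l\<in>I. (\<beta> l - a l \<bullet> x)\<^sup>2) + \<mu> / 2 * (norm x)\<^sup>2"

definition quad_grad :: "'i set \<Rightarrow> ('i \<Rightarrow> 'a::euclidean_space) \<Rightarrow> ('i \<Rightarrow> real) \<Rightarrow> real \<Rightarrow> real \<Rightarrow> 'a \<Rightarrow> 'a" where
  "quad_grad I a \<beta> w \<mu> x = w *\<^sub>R (\<Sum>l\<in>I. (a l \<bullet> x - \<beta> l) *\<^sub>R a l) + \<mu> *\<^sub>R x"

text \<open>\<open>grad\<close> is a definite description, so its value is available only after
  uniqueness: two gradients at a point give the same linear functional, hence the same
  vector.\<close>

lemma grad_eqI: "GDERIV f x :> g \<Longrightarrow> grad f x = g"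
  unfolding grad_def
proof (rule the_equality)
  fix g' assume "GDERIV f x :> g" "GDERIV f x :> g'"
  then have "(\<lambda>h. g \<bullet> h) = (\<lambda>h. g' \<bullet> h)"
    unfolding gderiv_def by (auto dest: has_derivative_unique simp: inner_commute)
  then show "g' = g"
    by (metis vector_eq_rdot)
qed

lemma GDERIV_quad: "GDERIV (quad I a \<beta> w \<mu>) x :> quad_grad I a \<beta> w \<mu> x"
  unfolding gderiv_def quad_def[abs_def] power2_norm_eq_inner
  by (auto intro!: derivative_eq_intros
      simp: fun_eq_iff quad_grad_def inner_simps inner_sum_right sum_distrib_left
        sum_negf[symmetric] inner_commute algebra_simps power2_eq_square intro!: sum.cong)

lemma grad_quad: "grad (quad I a \<beta> w \<mu>) = quad_grad I a \<beta> w \<mu>"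
  by (intro ext grad_eqI GDERIV_quad)

text \<open>The Taylor expansion of a quadratic is exact at order two. It yields strong convexity
  and, at a stationary point, quadratic growth.\<close>

lemma quad_expand:
  "quad I a \<beta> w \<mu> y = quad I a \<beta> w \<mu> x + quad_grad I a \<beta> w \<mu> x \<bullet> (y - x)
     + w / 2 * (\<Sum>l\<in>I. (a l \<bullet> (y - x))\<^sup>2) + \<mu> / 2 * (norm (y - x))\<^sup>2"
proof -
  have 1: "(\<Sum>l\<in>I. (\<beta> l - a l \<bullet> y)\<^sup>2) = (\<Sum>l\<in>I. (\<beta> l - a l \<bullet> x)\<^sup>2)
      + 2 * (\<Sum>l\<in>I. (a l \<bullet> x - \<beta> l) * (a l \<bullet> (y - x))) + (\<Sum>l\<in>I. (a l \<bullet> (y - x))\<^sup>2)"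
    unfolding sum_distrib_left sum.distrib[symmetric]
    by (intro sum.cong) (auto simp: inner_simps power2_eq_square algebra_simps)
  have 2: "(norm y)\<^sup>2 = (norm x)\<^sup>2 + 2 * (x \<bullet> (y - x)) + (norm (y - x))\<^sup>2"
    by (simp add: power2_norm_eq_inner inner_simps inner_commute)
  have 3: "quad_grad I a \<beta> w \<mu> x \<bullet> (y - x)
      = w * (\<Sum>l\<in>I. (a l \<bullet> x - \<beta> l) * (a l \<bullet> (y - x))) + \<mu> * (x \<bullet> (y - x))"
    unfolding quad_grad_def inner_add_left inner_scaleR_left inner_sum_left ..
  show ?thesis
    unfolding quad_def 1 2 3 by (simp add: field_simps)
qed

text \<open>Expanding at the convex combination \<open>z\<close> bounds both end values from below.
  The displacements from \<open>z\<close> are opposite multiples of \<open>x - y\<close>, so the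
  gradient terms cancel in the weighted sum.\<close>

lemma strongly_convex_quad:
  assumes "0 \<le> w"
  shows "strongly_convex \<mu> (quad I a \<beta> w \<mu>)"
  unfolding strongly_convex_def
proof (intro allI ballI)
  fix x y :: 'a and t :: real
  assume t: "t \<in> {0..1}"
  define z where "z = t *\<^sub>R x + (1 - t) *\<^sub>R y"
  let ?F = "quad I a \<beta> w \<mu>" and ?g = "quad_grad I a \<beta> w \<mu> z"
  have zx: "x - z = (1 - t) *\<^sub>R (x - y)" and zy: "y - z = (- t) *\<^sub>R (x - y)"
    by (auto simp: z_def algebra_simps)
  have "?F u \<ge> ?F z + ?g \<bullet> (u - z) + \<mu> / 2 * (norm (u - z))\<^sup>2" for u
    using assms by (subst quad_expand[of _ _ _ _ _ _ z]) (simp add: sum_nonneg)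
  from this[of x] this[of y]
  have x: "?F x \<ge> ?F z + (1 - t) * (?g \<bullet> (x - y)) + \<mu> / 2 * ((1 - t)\<^sup>2 * (norm (x - y))\<^sup>2)"
    and y: "?F y \<ge> ?F z - t * (?g \<bullet> (x - y)) + \<mu> / 2 * (t\<^sup>2 * (norm (x - y))\<^sup>2)"
    unfolding zx zy by (simp_all add: power_mult_distrib)
  have "t * ?F x + (1 - t) * ?F y \<ge>
      t * (?F z + (1 - t) * (?g \<bullet> (x - y)) + \<mu> / 2 * ((1 - t)\<^sup>2 * (norm (x - y))\<^sup>2))
    + (1 - t) * (?F z - t * (?g \<bullet> (x - y)) + \<mu> / 2 * (t\<^sup>2 * (norm (x - y))\<^sup>2))"
    using x y t by (intro add_mono mult_left_mono) auto
  also have "t * (?F z + (1 - t) * (?g \<bullet> (x - y)) + \<mu> / 2 * ((1 - t)\<^sup>2 * (norm (x - y))\<^sup>2))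
    + (1 - t) * (?F z - t * (?g \<bullet> (x - y)) + \<mu> / 2 * (t\<^sup>2 * (norm (x - y))\<^sup>2))
    = ?F z + \<mu> / 2 * t * (1 - t) * (norm (x - y))\<^sup>2"
    by (simp add: field_simps power2_eq_square)
  finally show "?F (t *\<^sub>R x + (1 - t) *\<^sub>R y)
      \<le> t * ?F x + (1 - t) * ?F y - \<mu> / 2 * t * (1 - t) * (norm (x - y))\<^sup>2"
    by (simp add: z_def)
qed

text \<open>Each \<open>a l\<close> is an eigenvector of the operator with eigenvalue
  \<open>a l \<bullet> a l\<close>, at most \<open>c\<close>. Hence the image \<open>M\<close>
  satisfies \<open>M \<bullet> M \<le> c * (M \<bullet> z)\<close>, and Cauchy-Schwarz
  finishes.\<close>

lemma norm_sum_inner_orthogonal_le: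
  fixes a :: "'i \<Rightarrow> 'a::euclidean_space"
  assumes "finite I" and orth: "pairwise (\<lambda>l m. a l \<bullet> a m = 0) I"
    and len: "\<And>l. l \<in> I \<Longrightarrow> a l \<bullet> a l \<le> c" and c: "0 \<le> c"
  shows "norm (\<Sum>l\<in>I. (a l \<bullet> z) *\<^sub>R a l) \<le> c * norm z"
proof -
  define M where "M = (\<Sum>l\<in>I. (a l \<bullet> z) *\<^sub>R a l)"
  have "a l \<bullet> M = (a l \<bullet> z) * (a l \<bullet> a l)" if "l \<in> I" for l
  proof -
    have "a l \<bullet> M = (\<Sum>m\<in>I. if m = l then (a l \<bullet> z) * (a l \<bullet> a l) else 0)"
      unfolding M_def inner_sum_right
      using orth that by (intro sum.cong) (auto simp: pairwise_def)
    then show ?thesis using that assms(1) by simp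
  qed
  then have "M \<bullet> M = (\<Sum>l\<in>I. (a l \<bullet> z)\<^sup>2 * (a l \<bullet> a l))"
    by (subst (1) M_def) (simp add: inner_sum_left power2_eq_square mult.assoc)
  also have "\<dots> \<le> (\<Sum>l\<in>I. (a l \<bullet> z)\<^sup>2 * c)"
    by (intro sum_mono mult_left_mono len) auto
  also have "\<dots> = c * (M \<bullet> z)"
    by (simp add: M_def inner_sum_left sum_distrib_left power2_eq_square mult.commute)
  finally have "norm M * norm M \<le> c * (M \<bullet> z)"
    by (simp add: dot_square_norm power2_eq_square)
  also have "\<dots> \<le> norm M * (c * norm z)"
    using mult_left_mono[OF norm_cauchy_schwarz[of M z] c] by (simp add: mult.left_commute)
  finally show ?thesis
    using c by (cases "M = 0") (simp_all add: M_def[symmetric])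
qed

lemma smooth_quad:
  fixes a :: "'i \<Rightarrow> 'a::euclidean_space"
  assumes "finite I" "pairwise (\<lambda>l m. a l \<bullet> a m = 0) I" "\<And>l. l \<in> I \<Longrightarrow> a l \<bullet> a l \<le> c"
    and "0 \<le> c" "0 \<le> w" "0 \<le> \<mu>"
  shows "smooth (w * c + \<mu>) (quad I a \<beta> w \<mu>)"
  unfolding smooth_def grad_quad
proof (intro conjI allI GDERIV_quad lipschitz_onI)
  fix x y :: 'a
  have "quad_grad I a \<beta> w \<mu> x - quad_grad I a \<beta> w \<mu> y
      = w *\<^sub>R (\<Sum>l\<in>I. (a l \<bullet> (x - y)) *\<^sub>R a l) + \<mu> *\<^sub>R (x - y)"
    unfolding quad_grad_def
    by (simp add: algebra_simps inner_diff_right sum.distrib sum_subtractf)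
  also have "norm \<dots> \<le> w * (c * norm (x - y)) + \<mu> * norm (x - y)"
    using norm_sum_inner_orthogonal_le[OF assms(1-4), of "x - y"] assms
    by (intro norm_triangle_mono) (auto intro: mult_left_mono)
  finally show "dist (quad_grad I a \<beta> w \<mu> x) (quad_grad I a \<beta> w \<mu> y) \<le> (w * c + \<mu>) * dist x y"
    by (simp add: dist_norm algebra_simps)
qed (use assms in auto)

lemma proper_closed_convex_indicator_zero:
  "proper_closed_convex (indicator_zero :: 'a::euclidean_space \<Rightarrow> ereal)"
proof -
  have "ereal_epigraph (indicator_zero :: 'a \<Rightarrow> ereal) = {0} \<times> {0..}"
    by (auto simp: ereal_epigraph_def indicator_zero_def split: if_splits)
  then show ?thesis
    unfolding proper_closed_convex_def
    by (auto simp: indicator_zero_def intro!: closed_Times convex_Times exI[of _ 0])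
qed

subsection \<open>The spectrum of the consensus matrix\<close>

lemma sum_UNIV_block:
  fixes blk :: "nat \<Rightarrow> 'b::finite" and f :: "'b \<times> 'd::finite \<Rightarrow> 'c::comm_monoid_add"
  assumes "bij_betw blk {1..n} UNIV"
  shows "(\<Sum>p\<in>UNIV. f p) = (\<Sum>i = 1..n. \<Sum>c\<in>UNIV. f (blk i, c))"
proof -
  have "(\<Sum>p\<in>UNIV. f p) = (\<Sum>b\<in>UNIV. \<Sum>c\<in>UNIV. f (b, c))"
    by (simp add: sum.cartesian_product)
  also have "\<dots> = (\<Sum>i = 1..n. \<Sum>c\<in>UNIV. f (blk i, c))"
    using sum.reindex_bij_betw[OF assms, of "\<lambda>b. \<Sum>c\<in>UNIV. f (b, c)"] by simp
  finally show ?thesis .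
qed

lemma bij_betw_eq_iff:
  assumes "bij_betw f S T" "i \<in> S" "j \<in> S"
  shows "f i = f j \<longleftrightarrow> i = j"
  using assms by (auto simp: bij_betw_def inj_on_def)

lemma bij_betw_UNIV_obtain:
  assumes "bij_betw f S UNIV"
  obtains i where "i \<in> S" "y = f i"
  using assms by (auto simp: bij_betw_def)

lemma consensus_matrix_mult_nth:
  fixes x :: "real^('b::finite \<times> 'd::finite)" and brow :: "nat \<Rightarrow> 'r::finite"
  assumes "bij_betw brow {1..n - 1} UNIV" "i \<in> {1..n - 1}"
  shows "(consensus_matrix n blk brow *v x) $ (brow i, c) = x $ (blk i, c) - x $ (blk (i + 1), c)"
  using arg_cong[OF consensus_matrix_block_row[OF assms, of blk x], of "\<lambda>u. u $ c"]
  by (simp add: block_def)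

text \<open>Extending \<open>v\<close> by zero to \<open>e\<close> gives the first and last block
  the same formula as the inner ones.\<close>

lemma transpose_consensus_matrix_mult_nth:
  fixes v :: "real^('r::finite \<times> 'd::finite)" and blk :: "nat \<Rightarrow> 'b::finite"
  assumes blk: "bij_betw blk {1..n} UNIV" and brow: "bij_betw brow {1..n - 1} UNIV"
    and i: "i \<in> {1..n}"
    and e: "\<And>j. e j = (if j \<in> {1..n - 1} then v $ (brow j, c) else 0)"
  shows "(transpose (consensus_matrix n blk brow) *v v) $ (blk i, c) = e i - e (i - 1)"
proof -
  let ?A = "consensus_matrix n blk brow :: real^('b \<times> 'd)^('r \<times> 'd)"
  have "(transpose ?A *v v) $ (blk i, c) = axis (blk i, c) 1 \<bullet> (transpose ?A *v v)"
    by (simp add: inner_axis')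
  also have "\<dots> = (?A *v axis (blk i, c) 1) \<bullet> v"
    by (metis dot_lmul_matrix transpose_matrix_vector transpose_transpose)
  also have "\<dots> = (\<Sum>j = 1..n - 1. \<Sum>c'\<in>UNIV. (?A *v axis (blk i, c) 1) $ (brow j, c') * v $ (brow j, c'))"
    by (simp add: inner_vec_def sum_UNIV_block[OF brow])
  also have "\<dots> = (\<Sum>j = 1..n - 1. \<Sum>c'\<in>UNIV.
      (if c' = c then (of_bool (j = i) - of_bool (j + 1 = i)) * v $ (brow j, c) else 0))"
    using bij_betw_eq_iff[OF blk _ i]
    by (intro sum.cong refl, subst consensus_matrix_mult_nth[OF brow]) (auto simp: axis_def)
  \<comment> \<open>For \<open>i = 1\<close> the index \<open>i - 1\<close> is 0 and lies outside
    the range, so the second sum vanishes, in agreement with \<open>e 0 = 0\<close>.\<close>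
  also have "\<dots> = (\<Sum>j = 1..n - 1. (if j = i then v $ (brow j, c) else 0))
      - (\<Sum>j = 1..n - 1. (if j = i - 1 then v $ (brow j, c) else 0))"
    unfolding sum_subtractf[symmetric] using i by (intro sum.cong refl) auto
  also have "\<dots> = e i - e (i - 1)"
    by (simp add: e)
  finally show ?thesis .
qed

lemma consensus_gram_mult_nth:
  fixes v :: "real^('r::finite \<times> 'd::finite)" and blk :: "nat \<Rightarrow> 'b::finite"
  assumes blk: "bij_betw blk {1..n} UNIV" and brow: "bij_betw brow {1..n - 1} UNIV"
    and i: "i \<in> {1..n - 1}"
    and e: "\<And>j. e j = (if j \<in> {1..n - 1} then v $ (brow j, c) else 0)"
  shows "((consensus_matrix n blk brow ** transpose (consensus_matrix n blk brow)) *v v) $ (brow i, c)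
    = 2 * e i - e (i - 1) - e (i + 1)"
proof -
  have *: "(transpose (consensus_matrix n blk brow) *v v) $ (blk j, c) = e j - e (j - 1)"
    if "j \<in> {1..n}" for j
    by (rule transpose_consensus_matrix_mult_nth[OF blk brow that e])
  have "i \<in> {1..n}" "i + 1 \<in> {1..n}" using i by auto
  then show ?thesis
    unfolding matrix_vector_mul_assoc[symmetric] consensus_matrix_mult_nth[OF brow i]
    by (simp add: * del: transpose_matrix_vector)
qed

text \<open>Discrete Green identity: the neighbour sum is symmetric up to boundary terms.\<close>

lemma sum_path_Green:
  fixes w f :: "nat \<Rightarrow> real"
  shows "(\<Sum>i = 1..m. w i * (f (i - 1) + f (i + 1)) - f i * (w (i - 1) + w (i + 1)))
    = w m * f (m + 1) - f m * w (m + 1) + f 0 * w 1 - w 0 * f 1"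
  by (induction m) (auto simp: algebra_simps)

lemma sin_path_eigenvector:
  "2 * sin (real i * x) - sin (real (i - 1) * x) - sin (real (i + 1) * x)
    = (2 - 2 * cos x) * sin (real i * x)" if "i \<ge> 1"
  using that by (simp add: of_nat_diff algebra_simps sin_add sin_diff)

lemma sin_path_pos:
  assumes "i \<in> {1..n - 1}"
  shows "sin (real i * (pi / real n)) > 0"
  using assms by (intro sin_gt_zero) (auto simp: field_simps)

text \<open>The absolute values of an eigenvector are paired with the positive eigenvector
  \<open>sin (i \<pi> / n)\<close>, as in the Perron--Frobenius theorem.\<close>

lemma path_eigenvalue_ge:
  fixes e :: "nat \<Rightarrow> real"
  assumes "e 0 = 0" "e n = 0"
    and eig: "\<And>i. i \<in> {1..n - 1} \<Longrightarrow> 2 * e i - e (i - 1) - e (i + 1) = t * e i"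
    and m: "m \<in> {1..n - 1}" "e m \<noteq> 0"
  shows "2 - 2 * cos (pi / real n) \<le> t"
proof -
  define w where "w i = sin (real i * (pi / real n))" for i
  define S where "S = (\<Sum>i = 1..n - 1. w i * \<bar>e i\<bar>)"
  have n: "n - 1 + 1 = n" "n > 0" using m by auto
  have w0: "w 0 = 0" "w n = 0" using n by (auto simp: w_def)
  have "S > 0"
    unfolding S_def
  proof (rule sum_pos2[of _ m])
    show "0 < w m * \<bar>e m\<bar>" using m sin_path_pos[OF m(1)] by (simp add: w_def)
    show "0 \<le> w i * \<bar>e i\<bar>" if "i \<in> {1..n - 1}" for i
      using sin_path_pos[OF that] by (simp add: w_def)
  qed (use m in auto)
  \<comment> \<open>By the triangle inequality the absolute values satisfy the eigenvalue equation
    as an inequality; the positive weights \<open>w i\<close> preserve it.\<close>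
  have "(2 - t) * S \<le> (\<Sum>i = 1..n - 1. w i * (\<bar>e (i - 1)\<bar> + \<bar>e (i + 1)\<bar>))"
    unfolding S_def sum_distrib_left
  proof (intro sum_mono)
    fix i assume i: "i \<in> {1..n - 1}"
    have "(2 - t) * e i = e (i - 1) + e (i + 1)"
      using eig[OF i] by (simp add: algebra_simps)
    then have "\<bar>2 - t\<bar> * \<bar>e i\<bar> \<le> \<bar>e (i - 1)\<bar> + \<bar>e (i + 1)\<bar>"
      by (metis abs_mult abs_triangle_ineq)
    moreover have "(2 - t) * \<bar>e i\<bar> \<le> \<bar>2 - t\<bar> * \<bar>e i\<bar>"
      by (intro mult_right_mono) auto
    ultimately have "w i * ((2 - t) * \<bar>e i\<bar>) \<le> w i * (\<bar>e (i - 1)\<bar> + \<bar>e (i + 1)\<bar>)"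
      using sin_path_pos[OF i] by (intro mult_left_mono) (auto simp: w_def)
    then show "(2 - t) * (w i * \<bar>e i\<bar>) \<le> w i * (\<bar>e (i - 1)\<bar> + \<bar>e (i + 1)\<bar>)"
      by (simp only: mult.left_commute)
  qed
  \<comment> \<open>Both sequences vanish at 0 and \<open>n\<close>, so Green's identity moves the
    neighbour sum onto the sine, where it is a multiple of \<open>w i\<close>.\<close>
  also have "\<dots> = (\<Sum>i = 1..n - 1. \<bar>e i\<bar> * (w (i - 1) + w (i + 1)))"
    using sum_path_Green[of w "\<lambda>i. \<bar>e i\<bar>" "n - 1"] assms(1,2) w0 n(1)
    by (simp add: sum_subtractf del: sum.cl_ivl_Suc)
  also have "\<dots> = 2 * cos (pi / real n) * S"
    unfolding S_def sum_distrib_left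
  proof (intro sum.cong refl)
    fix i assume "i \<in> {1..n - 1}"
    then have "w (i - 1) + w (i + 1) = 2 * cos (pi / real n) * w i"
      using sin_path_eigenvector[of i "pi / real n"] by (simp only: w_def) (simp add: algebra_simps)
    then show "\<bar>e i\<bar> * (w (i - 1) + w (i + 1)) = 2 * cos (pi / real n) * (w i * \<bar>e i\<bar>)"
      by simp
  qed
  finally show ?thesis using \<open>S > 0\<close> by simp
qed

lemma two_minus_two_cos: "2 - 2 * cos (x::real) = (2 * sin (x / 2))\<^sup>2"
  using cos_double_sin[of "x / 2"] by (simp add: power_mult_distrib)

text \<open>The sine vector attains the least eigenvalue \<open>2 - 2 * cos \<theta>\<close> of
  \<open>A A^T\<close>, and the half-angle formula exhibits it as a square.\<close>

lemma min_singular_value_consensus_matrix: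
  fixes blk :: "nat \<Rightarrow> 'b::finite" and brow :: "nat \<Rightarrow> 'r::finite"
  assumes blk: "bij_betw blk {1..n} UNIV" and brow: "bij_betw brow {1..n - 1} UNIV" and n: "n \<ge> 2"
  shows "min_singular_value (consensus_matrix n blk brow :: real^('b \<times> 'd::finite)^('r \<times> 'd))
    = 2 * sin (pi / (2 * real n))"
proof -
  let ?A = "consensus_matrix n blk brow :: real^('b \<times> 'd)^('r \<times> 'd)"
  define \<theta> where "\<theta> = pi / real n"
  define s where "s = 2 * sin (\<theta> / 2)"
  have s: "2 - 2 * cos \<theta> = s\<^sup>2" by (simp add: s_def two_minus_two_cos)
  have "s > 0" unfolding s_def using n by (auto intro!: mult_pos_pos sin_gt_zero simp: \<theta>_def field_simps)
  have "CARD('b) = n" "CARD('r) = n - 1"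
    using bij_betw_same_card[OF blk] bij_betw_same_card[OF brow] by auto
  \<comment> \<open>There are no more rows than columns, so the definition of
    \<open>singular_values\<close> selects \<open>A A^T\<close>.\<close>
  then have card: "CARD('r \<times> 'd) \<le> CARD('b \<times> 'd)" by simp
  define idx where "idx = inv_into {1..n - 1} brow"
  have idx: "idx (brow i) = i" if "i \<in> {1..n - 1}" for i
    unfolding idx_def using brow that by (simp add: bij_betw_inv_into_left)
  define v :: "real^('r \<times> 'd)" where "v = (\<chi> p. sin (real (idx (fst p)) * \<theta>))"
  have "s \<in> singular_values ?A"
  proof -
    have "v $ (brow 1, c) > 0" for c
      using sin_path_pos[of 1 n] n idx[of 1] by (simp add: v_def \<theta>_def)
    then have "v \<noteq> 0" by (metis less_irrefl zero_index)
    moreover have "(?A ** transpose ?A) *v v = s\<^sup>2 *\<^sub>R v"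
    proof (simp add: vec_eq_iff, intro allI)
      fix r :: 'r and c :: 'd
      obtain i where i: "i \<in> {1..n - 1}" and r: "r = brow i"
        using bij_betw_UNIV_obtain[OF brow] by metis
      define e where "e j = (if j \<in> {1..n - 1} then v $ (brow j, c) else 0)" for j
      \<comment> \<open>The zero padding agrees with the sine at both ends, since
        \<open>sin 0 = sin pi = 0\<close>.\<close>
      have e: "e j = sin (real j * \<theta>)" if "j \<le> n" for j
        using that n idx[of j] by (cases "j = 0 \<or> j = n") (auto simp: e_def v_def \<theta>_def)
      have "((?A ** transpose ?A) *v v) $ (r, c) = 2 * e i - e (i - 1) - e (i + 1)"
        unfolding r by (rule consensus_gram_mult_nth[OF blk brow i e_def])
      also have "\<dots> = s\<^sup>2 * e i"
      proof -
        have "i \<le> n" "i - 1 \<le> n" "i + 1 \<le> n" "i \<ge> 1" using i by auto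
        then show ?thesis using sin_path_eigenvector[of i \<theta>] by (simp only: e s)
      qed
      also have "e i = v $ (r, c)" using i by (simp add: e_def r)
      finally show "((?A ** transpose ?A) *v v) $ (r, c) = s\<^sup>2 * v $ (r, c)" .
    qed
    ultimately show ?thesis using card \<open>s > 0\<close> by (auto simp: singular_values_def)
  qed
  moreover have "s \<le> s'" if s': "s' \<in> singular_values ?A" for s'
  proof -
    from s' card obtain u where "s' \<ge> 0" "u \<noteq> 0" and u: "(?A ** transpose ?A) *v u = s'\<^sup>2 *\<^sub>R u"
      unfolding singular_values_def by auto
    from \<open>u \<noteq> 0\<close> obtain r c where "u $ (r, c) \<noteq> 0" by (auto simp: vec_eq_iff)
    moreover obtain m where m: "m \<in> {1..n - 1}" and "r = brow m"
      using bij_betw_UNIV_obtain[OF brow] by metis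
    ultimately have um: "u $ (brow m, c) \<noteq> 0" by simp
    define e where "e j = (if j \<in> {1..n - 1} then u $ (brow j, c) else 0)" for j
    have "2 - 2 * cos \<theta> \<le> s'\<^sup>2"
      unfolding \<theta>_def
    proof (rule path_eigenvalue_ge[of e n "s'\<^sup>2" m])
      fix i assume i: "i \<in> {1..n - 1}"
      then have "2 * e i - e (i - 1) - e (i + 1) = s'\<^sup>2 * u $ (brow i, c)"
        using consensus_gram_mult_nth[OF blk brow i, of e u c] u by (simp add: e_def)
      then show "2 * e i - e (i - 1) - e (i + 1) = s'\<^sup>2 * e i"
        using i by (simp add: e_def)
    qed (use m um n in \<open>auto simp: e_def\<close>)
    then show ?thesis
      using \<open>s' \<ge> 0\<close> unfolding s by (rule power2_le_imp_le)
  qed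
  ultimately show ?thesis
    unfolding min_singular_value_def
    by (subst cInf_eq_minimum[of s]) (auto simp: s_def \<theta>_def field_simps)
qed

section \<open>Operator norm and condition number of the consensus matrix\<close>

lemma norm_consensus_matrix_mult:
  fixes x :: "real^('b::finite \<times> 'd::finite)" and brow :: "nat \<Rightarrow> 'r::finite"
  assumes blk: "bij_betw blk {1..n} UNIV" and brow: "bij_betw brow {1..n - 1} UNIV"
  shows "(norm (consensus_matrix n blk brow *v x))\<^sup>2
    = (\<Sum>c\<in>UNIV. \<Sum>i = 1..n - 1. (x $ (blk i, c) - x $ (blk (i + 1), c))\<^sup>2)"
    and "(norm x)\<^sup>2 = (\<Sum>c\<in>UNIV. \<Sum>i = 1..n. (x $ (blk i, c))\<^sup>2)"
  unfolding power2_norm_eq_inner inner_vec_def sum_UNIV_block[OF brow] sum_UNIV_block[OF blk]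
  by (subst sum.swap, intro sum.cong refl,
      simp add: consensus_matrix_mult_nth[OF brow, simplified] power2_eq_square)+

text \<open>Each difference costs at most twice the two squares involved. An end value occurs in
  only one difference; the resulting saving is needed when \<open>N = 1\<close>.\<close>

lemma sum_diff_squares_le:
  fixes f :: "nat \<Rightarrow> real"
  shows "(\<Sum>i = 1..n. (f i - f (i + 1))\<^sup>2) \<le> 4 * (\<Sum>i = 1..n + 1. (f i)\<^sup>2) - 2 * (f 1)\<^sup>2 - 2 * (f (n + 1))\<^sup>2"
proof (induction n)
  case (Suc n)
  have "(f (n + 1) - f (n + 2))\<^sup>2 \<le> 2 * (f (n + 1))\<^sup>2 + 2 * (f (n + 2))\<^sup>2"
    using zero_le_power2[of "f (n + 1) + f (n + 2)"] by (simp add: power2_sum power2_diff)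
  with Suc show ?case by simp
qed simp

text \<open>With \<open>x \<le> 1 / 2\<close>, the cubic Taylor bound gives
  \<open>sin x \<ge> 23 / 24 * x\<close>, and \<open>pi > 3\<close> turns this into
  \<open>23 / (32 * N)\<close>. The remaining factor \<open>(2 * N - 1) / N\<close> is at least
  \<open>3 / 2\<close>, which suffices.\<close>

lemma one_le_mult_sin:
  assumes "N \<ge> 2"
  shows "1 \<le> (2 * real N - 1) * sin (pi / (4 * real N))"
proof -
  define x where "x = pi / (4 * real N)"
  have N: "real N \<ge> 2" using assms by simp
  have x: "0 < x" "x \<le> 1 / 2" "x \<ge> 3 / (4 * real N)"
    using N pi_less_4 pi_gt3 by (auto simp: x_def field_simps)
  have "\<bar>sin x - (\<Sum>m<3. sin_coeff m * x ^ m)\<bar> \<le> inverse (fact 3) * \<bar>x\<bar> ^ 3"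
    by (rule Maclaurin_sin_bound)
  then have "\<bar>sin x - x\<bar> \<le> x ^ 3 / 6"
    using x(1) by (simp add: sin_coeff_def numeral_3_eq_3 fact_numeral)
  then have "sin x \<ge> x - x ^ 3 / 6" by linarith
  moreover have "x * x\<^sup>2 \<le> x * (1 / 2)\<^sup>2"
    using x by (intro mult_left_mono power_mono) auto
  ultimately have "sin x \<ge> x * (23 / 24)"
    by (simp add: power3_eq_cube power2_eq_square)
  then have "sin x \<ge> 23 / 32 / real N" using x(3) by simp
  then have "(2 * real N - 1) * sin x \<ge> (2 * real N - 1) * (23 / 32 / real N)"
    using N by (intro mult_left_mono) auto
  moreover have "(2 * real N - 1) * (23 / 32 / real N) \<ge> 1"
    using N by (simp add: field_simps)
  ultimately show ?thesis by (simp add: x_def)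
qed

lemma onorm_consensus_matrix_le:
  fixes blk :: "nat \<Rightarrow> 'b::finite" and brow :: "nat \<Rightarrow> 'r::finite"
  assumes blk: "bij_betw blk {1..2 * N} UNIV" and brow: "bij_betw brow {1..2 * N - 1} UNIV"
    and N: "N \<ge> 1"
  shows "onorm ((*v) (consensus_matrix (2 * N) blk brow :: real^('b \<times> 'd::finite)^('r \<times> 'd)))
    \<le> (2 * real N - 1) * (2 * sin (pi / (4 * real N)))"
proof -
  let ?A = "consensus_matrix (2 * N) blk brow :: real^('b \<times> 'd)^('r \<times> 'd)"
  \<comment> \<open>For \<open>N = 1\<close> the target equals
    \<open>2 * sin (pi / 4) = sqrt 2\<close>, so the general constant 2 would be too large.\<close>
  define C :: real where "C = (if N = 1 then sqrt 2 else 2)"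
  have "norm (?A *v x) \<le> C * norm x" for x
  proof (rule power2_le_imp_le)
    have "(\<Sum>i = 1..2 * N - 1. (f i - f (i + 1))\<^sup>2) \<le> C\<^sup>2 * (\<Sum>i = 1..2 * N. (f i)\<^sup>2)"
      for f :: "nat \<Rightarrow> real"
    proof (cases "N = 1")
      case True
      then show ?thesis using sum_diff_squares_le[of f 1] by (simp add: C_def numeral_2_eq_2)
    next
      case False
      have "2 * N - 1 + 1 = 2 * N" using N by simp
      then have "(\<Sum>i = 1..2 * N - 1. (f i - f (i + 1))\<^sup>2) \<le> 4 * (\<Sum>i = 1..2 * N. (f i)\<^sup>2)"
        using sum_diff_squares_le[of f "2 * N - 1"] zero_le_power2[of "f 1"] zero_le_power2[of "f (2 * N)"]
        by (simp only:)
      then show ?thesis using False by (simp add: C_def)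
    qed
    then show "(norm (?A *v x))\<^sup>2 \<le> (C * norm x)\<^sup>2"
      unfolding power_mult_distrib norm_consensus_matrix_mult[OF blk brow] sum_distrib_left[of "C\<^sup>2"]
      by (intro sum_mono) (simp add: sum_distrib_left)
  qed (auto simp: C_def)
  then have "onorm ((*v) ?A) \<le> C" by (rule onorm_bound[rotated]) (simp add: C_def)
  also have "C \<le> (2 * real N - 1) * (2 * sin (pi / (4 * real N)))"
  proof (cases "N = 1")
    case True
    then show ?thesis by (simp add: C_def sin_45)
  next
    case False
    then have "N \<ge> 2" using N by simp
    then show ?thesis using one_le_mult_sin[of N] False by (simp add: C_def)
  qed
  finally show ?thesis .
qed

lemma condition_number_consensus_matrix:
  fixes blk :: "nat \<Rightarrow> 'b::finite" and brow :: "nat \<Rightarrow> 'r::finite"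
  assumes blk: "bij_betw blk {1..2 * N} UNIV" and brow: "bij_betw brow {1..2 * N - 1} UNIV"
    and N: "N \<ge> 1"
  defines "A \<equiv> (consensus_matrix (2 * N) blk brow :: real^('b \<times> 'd::finite)^('r \<times> 'd))"
  shows "0 < min_singular_value A" "condition_number A \<le> 2 * real N - 1"
proof -
  have s: "min_singular_value A = 2 * sin (pi / (4 * real N))"
    unfolding A_def using min_singular_value_consensus_matrix[OF blk brow] N by simp
  have "0 < pi / (4 * real N)" "pi / (4 * real N) < pi" using N by (auto simp: field_simps)
  then show pos: "0 < min_singular_value A" unfolding s by (simp add: sin_gt_zero)
  show "condition_number A \<le> 2 * real N - 1"
    unfolding condition_number_def using pos onorm_consensus_matrix_le[OF assms(1-3), where 'd='d] s
    by (simp add: A_def divide_le_eq)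
qed

subsection \<open>The chain problem\<close>

text \<open>Infeasible points have infinite value, and quadratic growth over the feasible ones gives
  both existence and uniqueness.\<close>

lemma optimal_solution_indicator_zero_iff:
  assumes "0 < \<mu>" "A *v xs = 0"
    and growth: "\<And>x. A *v x = 0 \<Longrightarrow> f xs + \<mu> / 2 * (norm (x - xs))\<^sup>2 \<le> f x"
  shows "optimal_solution f indicator_zero A 0 x \<longleftrightarrow> x = xs"
proof
  assume "optimal_solution f indicator_zero A 0 x"
  then have "A *v x = 0" "f x \<le> f xs"
    using assms(2) unfolding optimal_solution_def
    by (auto simp: indicator_zero_def split: if_splits dest!: spec[of _ xs])
  then have "\<mu> / 2 * (norm (x - xs))\<^sup>2 \<le> 0" using growth[of x] by linarith
  then show "x = xs" using assms(1) by (simp add: mult_le_0_iff)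
next
  have "f xs \<le> f y" if "A *v y = 0" for y
    using growth[OF that] assms(1) by (smt (verit) divide_nonneg_nonneg mult_nonneg_nonneg zero_le_power2)
  then show "x = xs \<Longrightarrow> optimal_solution f indicator_zero A 0 x"
    using assms(2) unfolding optimal_solution_def by (auto simp: indicator_zero_def)
qed

text \<open>Summation by parts: the recurrence is the Euler-Lagrange equation of the left-hand form,
  and only the boundary term at \<open>n\<close> survives.\<close>

lemma sum_by_parts_recurrence:
  fixes y \<zeta> :: "nat \<Rightarrow> real"
  assumes "\<zeta> 0 = 0" "\<And>j. j \<in> {1..n} \<Longrightarrow> y (j + 1) = (2 + c) * y j - y (j - 1)"
  shows "(\<Sum>j<n. (y (j + 1) - y j) * (\<zeta> (j + 1) - \<zeta> j)) + c * (\<Sum>j = 1..n. y j * \<zeta> j)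
    = (y (n + 1) - y n) * \<zeta> n"
  using assms(2)
proof (induction n)
  case 0
  then show ?case using assms(1) by simp
next
  case (Suc n)
  have "y (Suc n + 1) = (2 + c) * y (Suc n) - y n" using Suc.prems[of "Suc n"] by simp
  moreover have "(\<Sum>j<n. (y (j + 1) - y j) * (\<zeta> (j + 1) - \<zeta> j)) + c * (\<Sum>j = 1..n. y j * \<zeta> j)
      = (y (n + 1) - y n) * \<zeta> n"
    using Suc by simp
  ultimately show ?case by (simp add: distrib_left left_diff_distrib right_diff_distrib distrib_right) 
qed

locale chain_problem =
  fixes N d :: nat and blk :: "nat \<Rightarrow> 'b::finite" and brow :: "nat \<Rightarrow> 'r::finite"
    and co :: "nat \<Rightarrow> 'd::finite"
  assumes N: "N \<ge> 1" and d: "d \<ge> 1"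
    and blk: "bij_betw blk {1..2 * N} UNIV"
    and brow: "bij_betw brow {1..2 * N - 1} UNIV"
    and co: "bij_betw co {1..d} UNIV"
begin

abbreviation A :: "real^('b \<times> 'd)^('r \<times> 'd)" where
  "A \<equiv> consensus_matrix (2 * N) blk brow"

text \<open>With \<open>offset\<close>, these encode the residuals of \<open>G\<close>:
  \<open>j = 0\<close> stands for the term with \<open>\<alpha>\<close>, and \<open>j > 0\<close>
  for the link between coordinate \<open>j\<close> of block \<open>N + i\<close> and coordinate
  \<open>j + 1\<close> of block \<open>i\<close>.\<close>

definition coupling :: "nat \<times> nat \<Rightarrow> real^('b \<times> 'd)" where
  "coupling = (\<lambda>(i, j). axis (blk i, co (j + 1)) 1 - (if j = 0 then 0 else axis (blk (N + i), co j) 1))"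

definition offset :: "real \<Rightarrow> nat \<times> nat \<Rightarrow> real" where
  "offset \<alpha> = (\<lambda>(i, j). if j = 0 then \<alpha> else 0)"

abbreviation pairs :: "(nat \<times> nat) set" where
  "pairs \<equiv> {1..N} \<times> {..<d}"

lemma blk_eq_iff [simp]: "i \<in> {1..2 * N} \<Longrightarrow> j \<in> {1..2 * N} \<Longrightarrow> blk i = blk j \<longleftrightarrow> i = j"
  by (rule bij_betw_eq_iff[OF blk])

lemma co_eq_iff [simp]: "i \<in> {1..d} \<Longrightarrow> j \<in> {1..d} \<Longrightarrow> co i = co j \<longleftrightarrow> i = j"
  by (rule bij_betw_eq_iff[OF co])

lemma sum_UNIV_coords:
  "(\<Sum>p\<in>UNIV. f p) = (\<Sum>i = 1..2 * N. \<Sum>j = 1..d. f (blk i, co j))" for f :: "_ \<Rightarrow> real"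
  unfolding sum_UNIV_block[OF blk] by (simp add: sum.reindex_bij_betw[OF co, symmetric])

lemma norm_eq_sum_coords: "(norm x)\<^sup>2 = (\<Sum>i = 1..2 * N. \<Sum>j = 1..d. (x $ (blk i, co j))\<^sup>2)"
  for x :: "real^('b \<times> 'd)"
  unfolding power2_norm_eq_inner inner_vec_def sum_UNIV_coords by (simp add: power2_eq_square)

lemma vec_eq_coordsI:
  assumes "\<And>i j. i \<in> {1..2 * N} \<Longrightarrow> j \<in> {1..d} \<Longrightarrow> x $ (blk i, co j) = z $ (blk i, co j)"
  shows "x = (z :: real^('b \<times> 'd))"
proof -
  have "x $ (b, c) = z $ (b, c)" for b c
    using assms bij_betw_UNIV_obtain[OF blk] bij_betw_UNIV_obtain[OF co] by metis
  then show ?thesis by (simp add: vec_eq_iff)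
qed

lemma coupling_inner:
  "coupling (i, j) \<bullet> x = x $ (blk i, co (j + 1)) - (if j = 0 then 0 else x $ (blk (N + i), co j))"
  by (simp add: coupling_def inner_diff_left inner_axis')

lemma coupling_nth:
  assumes "i \<in> {1..N}" "j < d" "p \<in> {1..2 * N}" "q \<in> {1..d}"
  shows "coupling (i, j) $ (blk p, co q)
    = of_bool (p = i \<and> q = j + 1) - of_bool (p = N + i \<and> q = j)"
proof -
  have "blk p = blk i \<longleftrightarrow> p = i" "blk p = blk (N + i) \<longleftrightarrow> p = N + i" "co q = co (j + 1) \<longleftrightarrow> q = j + 1"
    using assms by (auto intro!: blk_eq_iff co_eq_iff)
  moreover have "j \<noteq> 0 \<Longrightarrow> co q = co j \<longleftrightarrow> q = j"
    using assms by (intro co_eq_iff) auto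
  ultimately show ?thesis using assms by (auto simp: coupling_def axis_def)
qed

text \<open>Every coordinate of the stack enters at most one coupling vector, so distinct ones have
  disjoint supports.\<close>

lemma coupling_inner_coupling:
  assumes "l \<in> pairs" "m \<in> pairs"
  shows "coupling l \<bullet> coupling m = of_bool (l = m) * (if snd l = 0 then 1 else 2)"
proof -
  obtain i j where l: "l = (i, j)" "i \<in> {1..N}" "j < d" using assms(1) by (cases l) auto
  obtain i' j' where m: "m = (i', j')" "i' \<in> {1..N}" "j' < d" using assms(2) by (cases m) auto
  have "coupling m $ (blk i, co (j + 1)) = of_bool (l = m)"
    unfolding m(1) using l m by (subst coupling_nth) auto
  moreover have "coupling m $ (blk (N + i), co j) = - of_bool (l = m)" if "j \<noteq> 0"
    unfolding m(1) using l m that by (subst coupling_nth) auto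
  ultimately show ?thesis by (simp add: l(1) coupling_inner)
qed

lemma coupling_orthogonal: "pairwise (\<lambda>l m. coupling l \<bullet> coupling m = 0) pairs"
  by (simp add: pairwise_def coupling_inner_coupling)

lemma coupling_norm: "l \<in> pairs \<Longrightarrow> coupling l \<bullet> coupling l \<le> 2"
  by (simp add: coupling_inner_coupling)

text \<open>The weight is \<open>(L - \<mu>) / 2\<close> because \<open>quad\<close> halves it
  again. With coupling vectors of squared length at most 2, the smoothness constant becomes
  \<open>(L - \<mu>) / 2 * 2 + \<mu> = L\<close>.\<close>

lemma f0_eq_quad:
  "f0 L \<mu> \<alpha> N d blk co = quad pairs coupling (offset \<alpha>) ((L - \<mu>) / 2) \<mu>"
proof
  fix x :: "real^('b \<times> 'd)"
  define n where "n i = (\<Sum>j = 1..d. (x $ (blk i, co j))\<^sup>2)" for i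
  have n: "(norm (block blk x i))\<^sup>2 = n i" for i
    unfolding power2_norm_eq_inner inner_vec_def n_def
    by (simp add: block_def sum.reindex_bij_betw[OF co, symmetric] power2_eq_square)
  have s: "(\<Sum>i = 1..N. n i + n (N + i)) = (norm x)\<^sup>2"
  proof -
    have "(\<Sum>i = 1..2 * N. n i) = (\<Sum>i = 1..N. n i) + (\<Sum>i = N + 1..2 * N. n i)"
      using sum.ub_add_nat[of 1 N n N] by (simp add: mult_2)
    also have "(\<Sum>i = N + 1..2 * N. n i) = (\<Sum>i = 1..N. n (N + i))"
      using sum.shift_bounds_cl_nat_ivl[of n 1 N N] by (simp add: mult_2 add.commute)
    finally show ?thesis by (simp add: norm_eq_sum_coords n_def sum.distrib)
  qed
  have "(\<Sum>j<d. (offset \<alpha> (i, j) - coupling (i, j) \<bullet> x)\<^sup>2) = (\<alpha> - block blk x i $ co 1)\<^sup>2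
      + (\<Sum>j = 1..d - 1. (block blk x (N + i) $ co j - block blk x i $ co (j + 1))\<^sup>2)" for i
  proof -
    have "{..<d} = insert 0 {1..d - 1}" using d by auto
    then show ?thesis by (auto simp: offset_def coupling_inner block_def intro!: sum.cong)
  qed
  then have e: "(\<Sum>l\<in>pairs. (offset \<alpha> l - coupling l \<bullet> x)\<^sup>2) = (\<Sum>i = 1..N. (\<alpha> - block blk x i $ co 1)\<^sup>2
      + (\<Sum>j = 1..d - 1. (block blk x (N + i) $ co j - block blk x i $ co (j + 1))\<^sup>2))"
    by (subst sum.cartesian_product') auto
  show "f0 L \<mu> \<alpha> N d blk co x = quad pairs coupling (offset \<alpha>) ((L - \<mu>) / 2) \<mu> x"
    unfolding f0_def G_def quad_def n s[symmetric] e
    by (subst sum.distrib) (simp add: sum_distrib_left[symmetric] del: times_divide_eq_left)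
qed

lemma smooth_f0:
  assumes "0 < \<mu>" "\<mu> < L"
  shows "smooth L (f0 L \<mu> \<alpha> N d blk co)"
proof -
  have "(L - \<mu>) / 2 * 2 + \<mu> = L" by (simp add: field_simps)
  then show ?thesis
    using smooth_quad[OF _ coupling_orthogonal coupling_norm, of "(L - \<mu>) / 2" \<mu> "offset \<alpha>"] assms
    by (simp only: f0_eq_quad) simp
qed

lemma strongly_convex_f0: "\<mu> < L \<Longrightarrow> strongly_convex \<mu> (f0 L \<mu> \<alpha> N d blk co)"
  unfolding f0_eq_quad by (rule strongly_convex_quad) simp

section \<open>The consensus subspace and the minimiser\<close>

lemma consensus_coords:
  assumes "A *v x = 0" "i \<in> {1..2 * N}"
  shows "x $ (blk i, c) = x $ (blk 1, c)"
proof -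
  have "i \<ge> 1" using assms by simp
  then show ?thesis using assms(2)
  proof (induction i rule: dec_induct)
    case (step i)
    then show ?case
      using consensus_matrix_mult_nth[OF brow, of i blk x c] assms(1) by simp
  qed simp
qed

text \<open>Only \<open>y 1\<close> to \<open>y d\<close> enter the vector. The values
  \<open>y 0\<close> and \<open>y (d + 1)\<close> remain free to carry the boundary conditions of
  the recurrence.\<close>

definition stack :: "(nat \<Rightarrow> real) \<Rightarrow> real^('b \<times> 'd)" where
  "stack y = (\<chi> p. y (inv_into {1..d} co (snd p)))"

lemma stack_nth [simp]: "j \<in> {1..d} \<Longrightarrow> stack y $ (b, co j) = y j"
  unfolding stack_def using co by (simp add: bij_betw_inv_into_left)

lemma norm_stack: "(norm (stack y))\<^sup>2 = 2 * real N * (\<Sum>j = 1..d. (y j)\<^sup>2)"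
  by (simp add: norm_eq_sum_coords)

text \<open>Since \<open>stack\<close> ignores \<open>y 0\<close>, it can be normalised to 0, as
  summation by parts requires of a test direction.\<close>

lemma consensus_iff_stack: "A *v x = 0 \<longleftrightarrow> (\<exists>y. y 0 = 0 \<and> x = stack y)"
proof
  assume x: "A *v x = 0"
  define y where "y j = (if j = 0 then 0 else x $ (blk 1, co j))" for j
  have "x = stack y"
  proof (rule vec_eq_coordsI)
    fix i j assume "i \<in> {1..2 * N}" "j \<in> {1..d}"
    then show "x $ (blk i, co j) = stack y $ (blk i, co j)"
      using consensus_coords[OF x, of i "co j"] by (simp add: y_def)
  qed
  moreover have "y 0 = 0" by (simp add: y_def)
  ultimately show "\<exists>y. y 0 = 0 \<and> x = stack y" by blast
next
  assume "\<exists>y. y 0 = 0 \<and> x = stack y"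
  then obtain y where x: "x = stack y" by auto
  have "(A *v x) $ (r, c) = 0" for r c
  proof -
    obtain i where "i \<in> {1..2 * N - 1}" "r = brow i" using bij_betw_UNIV_obtain[OF brow] by metis
    then show ?thesis
      using consensus_matrix_mult_nth[OF brow, of i blk x c] by (simp add: x stack_def)
  qed
  then show "A *v x = 0" by (simp add: vec_eq_iff)
qed

text \<open>Stationarity along the consensus subspace: \<open>y 0 = \<alpha>\<close> is the
  Dirichlet condition at the source, and \<open>y (d + 1) = y d\<close> is a Neumann condition that
  removes the boundary term.\<close>

lemma quad_grad_stack:
  assumes "w > 0" "y 0 = \<alpha>" "y (d + 1) = y d"
    and rec: "\<And>j. j \<in> {1..d} \<Longrightarrow> y (j + 1) = (2 + 2 * \<mu> / w) * y j - y (j - 1)"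
    and \<zeta>: "\<zeta> 0 = 0"
  shows "quad_grad pairs coupling (offset \<alpha>) w \<mu> (stack y) \<bullet> stack \<zeta> = 0"
proof -
  \<comment> \<open>Taking \<open>y 0 = \<alpha>\<close> absorbs the offset, so the term
    \<open>j = 0\<close> has the same form as the others.\<close>
  have *: "(coupling (i, j) \<bullet> stack y - offset \<alpha> (i, j)) * (coupling (i, j) \<bullet> stack \<zeta>)
      = (y (j + 1) - y j) * (\<zeta> (j + 1) - \<zeta> j)" if "j < d" for i j
    using that assms(2) \<zeta> by (cases "j = 0") (simp_all add: coupling_inner offset_def Suc_le_eq)
  define S where "S = (\<Sum>j<d. (y (j + 1) - y j) * (\<zeta> (j + 1) - \<zeta> j))"
  define T where "T = (\<Sum>j = 1..d. y j * \<zeta> j)"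
  have "(\<Sum>l\<in>pairs. (coupling l \<bullet> stack y - offset \<alpha> l) * (coupling l \<bullet> stack \<zeta>)) = real N * S"
    by (subst sum.cartesian_product') (simp add: * S_def)
  moreover have "stack y \<bullet> stack \<zeta> = 2 * real N * T"
    by (simp add: inner_vec_def sum_UNIV_coords T_def)
  ultimately have "quad_grad pairs coupling (offset \<alpha>) w \<mu> (stack y) \<bullet> stack \<zeta>
      = real N * w * (S + 2 * \<mu> / w * T)"
    using assms(1) unfolding quad_grad_def inner_add_left inner_scaleR_left inner_sum_left
    by (simp only:) (simp add: field_simps)
  also have "S + 2 * \<mu> / w * T = 0"
    using sum_by_parts_recurrence[of \<zeta> d y "2 * \<mu> / w", OF \<zeta> rec] assms(3)
    by (simp add: S_def T_def)
  finally show ?thesis by simp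
qed

lemma optimal_solution_f0_iff:
  assumes "0 < \<mu>" "\<mu> < L" "y 0 = \<alpha>" "y (d + 1) = y d"
    and rec: "\<And>j. j \<in> {1..d} \<Longrightarrow> y (j + 1) = (2 + 4 * \<mu> / (L - \<mu>)) * y j - y (j - 1)"
  shows "optimal_solution (f0 L \<mu> \<alpha> N d blk co) indicator_zero A 0 x \<longleftrightarrow> x = stack y"
proof (rule optimal_solution_indicator_zero_iff[OF assms(1)])
  show *: "A *v stack y = 0"
    unfolding consensus_iff_stack
    by (rule exI[of _ "y(0 := 0)"]) (auto intro!: vec_eq_coordsI)
  fix x assume "A *v x = 0"
  then have "A *v (x - stack y) = 0" using * by (simp add: matrix_vector_mult_diff_distrib)
  then obtain \<zeta> where \<zeta>: "\<zeta> 0 = 0" "x - stack y = stack \<zeta>" unfolding consensus_iff_stack by auto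
  have "quad_grad pairs coupling (offset \<alpha>) ((L - \<mu>) / 2) \<mu> (stack y) \<bullet> (x - stack y) = 0"
    unfolding \<zeta>(2) using assms \<zeta>(1) by (intro quad_grad_stack) (auto simp: rec)
  then show "f0 L \<mu> \<alpha> N d blk co (stack y) + \<mu> / 2 * (norm (x - stack y))\<^sup>2 \<le> f0 L \<mu> \<alpha> N d blk co x"
    unfolding f0_eq_quad using assms(2)
    by (subst quad_expand[of _ _ _ _ _ x "stack y"]) (simp add: sum_nonneg)
qed

section \<open>Propagation of nonzero coordinates through the algorithm\<close>

text \<open>Coordinate \<open>j\<close> of block \<open>i\<close> can be nonzero at time \<open>t\<close> only if
  \<open>j (N + 1) + i \<le> 2 N + t\<close>: the objective couples coordinate \<open>j + 1\<close> of block \<open>i \<le> N\<close>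
  only to coordinate \<open>j\<close> of block \<open>N + i\<close>, which raises \<open>j (N + 1) + i\<close> by one, and the
  constraint couples neighbouring blocks.\<close>

definition reach :: "nat \<Rightarrow> (real^('b \<times> 'd)) set" where
  "reach t = {x. \<forall>i\<in>{1..2 * N}. \<forall>j\<in>{1..d}.
     2 * N + t < j * (N + 1) + i \<longrightarrow> x $ (blk i, co j) = 0}"

lemma reachD:
  "x \<in> reach t \<Longrightarrow> i \<in> {1..2 * N} \<Longrightarrow> j \<in> {1..d} \<Longrightarrow> x $ (blk i, co j) \<noteq> 0
    \<Longrightarrow> j * (N + 1) + i \<le> 2 * N + t"
  unfolding reach_def not_le[symmetric] by blast

lemma subspace_reach: "subspace (reach t)"
  unfolding subspace_def reach_def by auto

lemma reach_mono: "s \<le> t \<Longrightarrow> reach s \<subseteq> reach t"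
  unfolding reach_def by fastforce

text \<open>The two entries of the vector have levels \<open>(j + 1) * (N + 1) + i\<close> and one
  less, so bounding the higher level suffices.\<close>

lemma coupling_in_reach:
  assumes "i \<in> {1..N}" "j < d" "(j + 1) * (N + 1) + i \<le> 2 * N + t"
  shows "coupling (i, j) \<in> reach t"
  unfolding reach_def using assms by (auto simp: coupling_nth)

text \<open>A coupling vector contributes only if its residual is nonzero, so for
  \<open>j > 0\<close> one of its two coordinates must already be active; their levels differ by
  one.\<close>

lemma grad_f0_in_reach:
  assumes x: "x \<in> reach t"
  shows "grad (f0 L \<mu> \<alpha> N d blk co) x \<in> reach (Suc t)"
proof -
  have "(coupling l \<bullet> x - offset \<alpha> l) *\<^sub>R coupling l \<in> reach (Suc t)" if l: "l \<in> pairs" for l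
  proof (cases "coupling l \<bullet> x = offset \<alpha> l")
    case True
    then show ?thesis using subspace_0[OF subspace_reach] by simp
  next
    case False
    obtain i j where l: "l = (i, j)" "i \<in> {1..N}" "j < d" using l by (cases l) auto
    have "(j + 1) * (N + 1) + i \<le> 2 * N + Suc t"
    \<comment> \<open>The source \<open>\<alpha>\<close> can activate coordinate 1 of the first
      \<open>N\<close> blocks at once: its level \<open>N + 1 + i\<close> is at most
      \<open>2 * N + 1\<close>.\<close>
    proof (cases "j = 0")
      case True then show ?thesis using l by simp
    next
      case j: False
      then have "x $ (blk i, co (j + 1)) \<noteq> 0 \<or> x $ (blk (N + i), co j) \<noteq> 0"
        using False by (auto simp: l coupling_inner offset_def)
      then consider "x $ (blk i, co (j + 1)) \<noteq> 0" | "x $ (blk (N + i), co j) \<noteq> 0"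
        by blast
      then show ?thesis
      proof cases
        case 1
        then show ?thesis using reachD[OF x _ _ 1] l by auto
      next
        case 2
        then show ?thesis using reachD[OF x _ _ 2] l j by auto
      qed
    qed
    then show ?thesis
      unfolding l(1) using l by (intro subspace_scale[OF subspace_reach] coupling_in_reach)
  qed
  moreover have "x \<in> reach (Suc t)" using x reach_mono[of t "Suc t"] by auto
  ultimately show ?thesis
    unfolding f0_eq_quad grad_quad quad_grad_def
    by (blast intro: subspace_reach subspace_add subspace_scale subspace_sum)
qed

lemma consensus_gram_in_reach:
  assumes x: "x \<in> reach t"
  shows "transpose A *v (A *v x - 0) \<in> reach (Suc t)"
  unfolding reach_def
proof (intro CollectI ballI impI)
  fix i j assume i: "i \<in> {1..2 * N}" and j: "j \<in> {1..d}"
    and far: "2 * N + Suc t < j * (N + 1) + i"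
  define e where "e m = (if m \<in> {1..2 * N - 1} then (A *v x - 0) $ (brow m, co j) else 0)" for m
  have e: "e m = x $ (blk m, co j) - x $ (blk (m + 1), co j)" if "m \<in> {1..2 * N - 1}" for m
    using that consensus_matrix_mult_nth[OF brow that, of blk x] by (simp add: e_def)
  show "(transpose A *v (A *v x - 0)) $ (blk i, co j) = 0"
  proof (rule ccontr)
    assume "(transpose A *v (A *v x - 0)) $ (blk i, co j) \<noteq> 0"
    then have "e i - e (i - 1) \<noteq> 0"
      unfolding transpose_consensus_matrix_mult_nth[OF blk brow i e_def] .
    \<comment> \<open>At a fixed coordinate \<open>A^T A\<close> is tridiagonal in the block index,
      so a nonzero entry at block \<open>i\<close> needs one of \<open>x\<close> at block
      \<open>i - 1\<close> or later.\<close>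
    then have "\<exists>m\<in>{1..2 * N}. x $ (blk m, co j) \<noteq> 0 \<and> i \<le> m + 1"
    proof (cases "e i = 0")
      case True
      with \<open>e i - e (i - 1) \<noteq> 0\<close> have ne: "e (i - 1) \<noteq> 0" by simp
      then have m: "i - 1 \<in> {1..2 * N - 1}" by (auto simp: e_def split: if_splits)
      then have "x $ (blk (i - 1), co j) \<noteq> 0 \<or> x $ (blk i, co j) \<noteq> 0" using ne e[OF m] i by auto
      then show ?thesis using i m by fastforce
    next
      case False
      then have m: "i \<in> {1..2 * N - 1}" by (auto simp: e_def split: if_splits)
      then have "x $ (blk i, co j) \<noteq> 0 \<or> x $ (blk (i + 1), co j) \<noteq> 0" using False e[OF m] by auto
      then show ?thesis using i m by fastforce
    qed
    then show False
      using reachD[OF x _ j] far by fastforce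
  qed
qed

text \<open>The next span draws on all earlier ones, hence the strong induction; the sets
  \<open>reach t\<close> are nested subspaces.\<close>

lemma span_space_subset_reach:
  assumes "linear_span_iterates (f0 L \<mu> \<alpha> N d blk co) A 0 X"
  shows "span_space (f0 L \<mu> \<alpha> N d blk co) A 0 X t \<subseteq> reach t"
proof (induction t rule: less_induct)
  case (less t)
  have X: "X 0 = 0" "X i \<in> span_space (f0 L \<mu> \<alpha> N d blk co) A 0 X i" for i
    using assms by (auto simp: linear_span_iterates_def)
  show ?case
  proof (cases t)
    case 0
    then show ?thesis using X subspace_0[OF subspace_reach] by simp
  next
    case (Suc k)
    have sub: "span_space (f0 L \<mu> \<alpha> N d blk co) A 0 X i \<subseteq> reach k" if "i \<le> k" for i
      using less[of i] reach_mono[OF that] that Suc by fastforce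
    have "X i \<in> reach (Suc k)" if "i \<le> k" for i
      using X(2)[of i] sub[OF that] reach_mono[of k "Suc k"] by auto
    then show ?thesis
      unfolding Suc span_space.simps
      by (intro span_minimal subspace_reach)
        (use sub in \<open>blast intro: grad_f0_in_reach consensus_gram_in_reach\<close>)
  qed
qed

text \<open>Coordinates beyond \<open>K\<close> in the last \<open>N\<close> blocks have level at
  least \<open>(K + 2) * (N + 1)\<close>, which exceeds \<open>2 * N + k\<close> exactly when
  \<open>k < 2 + K * (N + 1)\<close>. There the iterate is 0 and the error is the minimiser
  itself.\<close>

lemma norm_iterate_minus_stack_ge:
  assumes X: "linear_span_iterates (f0 L \<mu> \<alpha> N d blk co) A 0 X"
    and K: "k < 2 + K * (N + 1)" "K \<le> d"
  shows "(norm (X k - stack y))\<^sup>2 \<ge> real N * (\<Sum>j = K + 1..d. (y j)\<^sup>2)"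
proof -
  have "X k \<in> reach k"
    using span_space_subset_reach[OF X, of k] X by (auto simp: linear_span_iterates_def)
  note * = reachD[OF this]
  have "X k $ (blk i, co j) = 0" if "i \<in> {N + 1..2 * N}" "j \<in> {K + 1..d}" for i j
  proof (rule ccontr)
    assume "X k $ (blk i, co j) \<noteq> 0"
    then have "j * (N + 1) + i \<le> 2 * N + k" using that by (intro *) auto
    moreover have "(K + 1) * (N + 1) \<le> j * (N + 1)" using that by (intro mult_le_mono1) auto
    ultimately show False using K(1) that by (simp add: algebra_simps)
  qed
  then have "real N * (\<Sum>j = K + 1..d. (y j)\<^sup>2)
      = (\<Sum>i = N + 1..2 * N. \<Sum>j = K + 1..d. ((X k - stack y) $ (blk i, co j))\<^sup>2)"
    by simp
  also have "\<dots> \<le> (\<Sum>i = N + 1..2 * N. \<Sum>j = 1..d. ((X k - stack y) $ (blk i, co j))\<^sup>2)"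
    by (intro sum_mono sum_mono2) auto
  also have "\<dots> \<le> (norm (X k - stack y))\<^sup>2"
    unfolding norm_eq_sum_coords by (intro sum_mono2) (auto intro: sum_nonneg)
  finally show ?thesis .
qed

end

subsection \<open>The decay of the minimiser\<close>

text \<open>\<open>q\<close> is the root below 1 of the characteristic equation of the recurrence;
  the other root is \<open>1 / q\<close>.\<close>

lemma contraction_factor_char_eq:
  assumes "0 < \<mu>" "\<mu> < L"
  defines "q \<equiv> (sqrt (L / \<mu>) - 1) / (sqrt (L / \<mu>) + 1)"
  shows "0 < q" "q < 1" "q\<^sup>2 + 1 = (2 + 4 * \<mu> / (L - \<mu>)) * q"
proof -
  define s where "s = sqrt (L / \<mu>)"
  have s: "s\<^sup>2 = L / \<mu>" "1 < s" using assms by (auto simp: s_def)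
  then have L: "L = s\<^sup>2 * \<mu>" using assms(1) by (simp add: field_simps)
  have "s\<^sup>2 - 1 \<noteq> 0" using s(2) by (simp add: power2_eq_1_iff)
  have "4 * \<mu> / (L - \<mu>) = 4 * \<mu> / (\<mu> * (s\<^sup>2 - 1))" unfolding L by (simp add: algebra_simps)
  also have "\<dots> = 4 / (s\<^sup>2 - 1)" using assms(1) by simp
  also have "s\<^sup>2 - 1 = (s - 1) * (s + 1)" by (simp add: power2_eq_square algebra_simps)
  finally have c: "4 * \<mu> / (L - \<mu>) = 4 / ((s - 1) * (s + 1))" .
  have q: "q = (s - 1) / (s + 1)" by (simp add: q_def s_def)
  show "0 < q" "q < 1" using s(2) by (auto simp: q)
  show "q\<^sup>2 + 1 = (2 + 4 * \<mu> / (L - \<mu>)) * q"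
    unfolding c q using s(2) by (simp add: divide_simps) (simp add: algebra_simps power2_eq_square)
qed

text \<open>The general solution of the recurrence \<open>y (j + 1) = (q + 1 / q) * y j - y (j - 1)\<close> is
  a combination of the powers \<open>q\<^sup>j\<close> and \<open>q\<^sup>-\<^sup>j\<close>; this one is symmetric about \<open>d + 1/2\<close>.\<close>

definition profile :: "real \<Rightarrow> nat \<Rightarrow> nat \<Rightarrow> real" where
  "profile q d j = q ^ j + q ^ (2 * d + 1 - j)"

lemma profile_boundary: "profile q d (d + 1) = profile q d d"
  by (simp add: profile_def mult_2)

lemma profile_recurrence:
  assumes "q\<^sup>2 + 1 = c * q" "j \<in> {1..d}"
  shows "profile q d (j + 1) = c * profile q d j - profile q d (j - 1)"
proof -
  obtain i where i: "j = i + 1" using assms(2) by (metis atLeastAtMost_iff le_add_diff_inverse2)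
  define m where "m = 2 * d - j"
  have m: "2 * d + 1 - (j + 1) = m" "2 * d + 1 - j = m + 1" "2 * d + 1 - (j - 1) = m + 2"
    using assms(2) by (auto simp: m_def)
  have "q ^ n + q ^ (n + 2) = c * q ^ (n + 1)" for n
  proof -
    have "q ^ n + q ^ (n + 2) = q ^ n * (q\<^sup>2 + 1)" by (simp add: algebra_simps power2_eq_square)
    also have "\<dots> = c * q ^ (n + 1)" unfolding assms(1) by simp
    finally show ?thesis .
  qed
  from this[of i] this[of m] show ?thesis
    unfolding profile_def m by (simp add: i algebra_simps)
qed

lemma profile_pos: "0 < q \<Longrightarrow> 0 < profile q d j"
  by (simp add: profile_def add_pos_pos)

text \<open>Shifting the index by \<open>K\<close> multiplies \<open>q ^ j\<close> by exactly
  \<open>q ^ K\<close> and increases the reflected term. Hence the second half of the profile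
  dominates \<open>q ^ K\<close> times the first half, entry by entry.\<close>

lemma profile_tail_ge:
  assumes "0 < q" "q < 1"
  shows "q ^ (2 * K) * (\<Sum>j = 1..K. (profile q (2 * K) j)\<^sup>2) \<le> (\<Sum>j = K + 1..2 * K. (profile q (2 * K) j)\<^sup>2)"
proof -
  have "q ^ (2 * K) * (\<Sum>j = 1..K. (profile q (2 * K) j)\<^sup>2) = (\<Sum>j = 1..K. (q ^ K * profile q (2 * K) j)\<^sup>2)"
    by (simp add: sum_distrib_left power_mult_distrib mult.commute[of 2] power_mult)
  also have "\<dots> \<le> (\<Sum>j = 1..K. (profile q (2 * K) (j + K))\<^sup>2)"
  proof (intro sum_mono power_mono)
    fix j assume j: "j \<in> {1..K}"
    have "q ^ (K + (4 * K + 1 - j)) \<le> q ^ (4 * K + 1 - (j + K))"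
      using assms j by (intro power_decreasing) auto
    then show "q ^ K * profile q (2 * K) j \<le> profile q (2 * K) (j + K)"
      by (simp add: profile_def distrib_left power_add[symmetric] add.commute)
  qed (use assms profile_pos[of q] in \<open>auto intro: less_imp_le\<close>)
  also have "\<dots> = (\<Sum>j = K + 1..2 * K. (profile q (2 * K) j)\<^sup>2)"
    using sum.shift_bounds_cl_nat_ivl[of "\<lambda>j. (profile q (2 * K) j)\<^sup>2" 1 K K]
    by (simp add: mult_2)
  finally show ?thesis .
qed

section \<open>Scaling of the minimiser and the final estimate\<close>

theorem theorem4:
  fixes L\<^sub>f \<mu>\<^sub>f \<kappa>\<^sub>A \<kappa>\<^sub>f D :: real and N k K d :: nat
    and blk :: "nat \<Rightarrow> 'b::finite" and brow :: "nat \<Rightarrow> 'r::finite" and co :: "nat \<Rightarrow> 'd::finite"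
  assumes "\<mu>\<^sub>f > 0" and "L\<^sub>f > \<mu>\<^sub>f" and "\<kappa>\<^sub>A \<ge> 1" and "D > 0"
    and "\<kappa>\<^sub>f = L\<^sub>f / \<mu>\<^sub>f"
    and "N = nat \<lfloor>(\<kappa>\<^sub>A + 1) / 2\<rfloor>"
    and "k \<ge> N" and "k \<ge> 2"
    and "K = nat \<lfloor>(real k - 2) / (real N + 1)\<rfloor> + 1"
    and "d = 2 * K"
    and "bij_betw blk {1..2 * N} UNIV"
    and "bij_betw brow {1..2 * N - 1} UNIV"
    and "bij_betw co {1..d} UNIV"
  shows "\<exists>\<alpha>>0.
    let f = f0 L\<^sub>f \<mu>\<^sub>f \<alpha> N d blk co;
        A = (consensus_matrix (2 * N) blk brow :: real^('b \<times> 'd)^('r \<times> 'd))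
    in in_F_SC L\<^sub>f \<mu>\<^sub>f \<kappa>\<^sub>A D f indicator_zero A 0 0 \<and>
       (\<forall>xs X. optimal_solution f indicator_zero A 0 xs \<longrightarrow> linear_span_iterates f A 0 X \<longrightarrow>
          norm (X k - xs) \<ge>
            1 / 2 * ((sqrt \<kappa>\<^sub>f - 1) / (sqrt \<kappa>\<^sub>f + 1)) powr (2 * real k / real N) * norm (X 0 - xs))"
proof -
  have "\<lfloor>(\<kappa>\<^sub>A + 1) / 2\<rfloor> \<ge> 1" using assms(3) by simp
  then have N: "N \<ge> 1" and "real N = of_int \<lfloor>(\<kappa>\<^sub>A + 1) / 2\<rfloor>"
    unfolding assms(6) by linarith+
  then have "real N \<le> (\<kappa>\<^sub>A + 1) / 2" by (simp only: of_int_floor_le)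
  then have N\<kappa>: "2 * real N - 1 \<le> \<kappa>\<^sub>A" by simp
  define r where "r = (real k - 2) / (real N + 1)"
  have "r \<ge> 0" using assms(8) by (simp add: r_def)
  then have "real K = of_int \<lfloor>r\<rfloor> + 1" unfolding assms(9) r_def by simp
  then have K: "r < real K" "real K \<le> r + 1" by linarith+
  have "real k - 2 < real K * (real N + 1)" using K(1) by (simp add: r_def field_simps)
  then have "real k < real (2 + K * (N + 1))" by (simp add: algebra_simps)
  then have kK: "k < 2 + K * (N + 1)" by (simp only: of_nat_less_iff)
  \<comment> \<open>The floor gives \<open>K \<le> (k + N - 1) / (N + 1)\<close>, and
    \<open>k \<ge> N\<close> bounds the numerator by \<open>2 * k\<close>.\<close>
  have Kk: "real K \<le> 2 * real k / real N"
  proof -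
    have "real N * (real k + real N - 1) \<le> real N * (2 * real k)"
      using assms(7) by (intro mult_left_mono) auto
    also have "\<dots> \<le> 2 * real k * (real N + 1)" by (simp add: algebra_simps)
    finally have "(real k + real N - 1) / (real N + 1) \<le> 2 * real k / real N"
      using N by (simp add: field_simps)
    moreover have "r + 1 = (real k + real N - 1) / (real N + 1)" by (simp add: r_def field_simps)
    ultimately show ?thesis using K(2) by simp
  qed

  interpret chain_problem N d blk brow co
    using assms(9-13) N by unfold_locales auto

  define q where "q = (sqrt \<kappa>\<^sub>f - 1) / (sqrt \<kappa>\<^sub>f + 1)"
  have q: "0 < q" "q < 1" "q\<^sup>2 + 1 = (2 + 4 * \<mu>\<^sub>f / (L\<^sub>f - \<mu>\<^sub>f)) * q"
    unfolding q_def assms(5) by (rule contraction_factor_char_eq[OF assms(1,2)])+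
  define P where "P = (\<Sum>j = 1..d. (profile q d j)\<^sup>2)"
  have "P > 0"
    unfolding P_def using d by (intro sum_pos zero_less_power profile_pos[OF q(1)]) auto
  \<comment> \<open>This scale places the minimiser at distance exactly \<open>D\<close> from the
    origin; \<open>\<alpha>\<close> is then read off as the boundary value
    \<open>y 0\<close>.\<close>
  define a where "a = D / sqrt (2 * real N * P)"
  have "a > 0" unfolding a_def using assms(4) \<open>P > 0\<close> N by auto
  define y where "y j = a * profile q d j" for j
  define \<alpha> where "\<alpha> = y 0"
  have "\<alpha> > 0" unfolding \<alpha>_def y_def using \<open>a > 0\<close> profile_pos[OF q(1)] by simp
  define f where "f = f0 L\<^sub>f \<mu>\<^sub>f \<alpha> N d blk co"
  have opt: "optimal_solution f indicator_zero A 0 x \<longleftrightarrow> x = stack y" for x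
    unfolding f_def using assms(1,2)
  proof (rule optimal_solution_f0_iff)
    show "y (d + 1) = y d" unfolding y_def profile_boundary ..
    show "y (j + 1) = (2 + 4 * \<mu>\<^sub>f / (L\<^sub>f - \<mu>\<^sub>f)) * y j - y (j - 1)" if "j \<in> {1..d}" for j
      unfolding y_def profile_recurrence[OF q(3) that] by (simp add: algebra_simps)
  qed (simp add: \<alpha>_def)
  have y2: "(\<Sum>j\<in>J. (y j)\<^sup>2) = a\<^sup>2 * (\<Sum>j\<in>J. (profile q d j)\<^sup>2)" for J
    by (simp add: y_def power_mult_distrib sum_distrib_left)
  have nrm: "(norm (stack y))\<^sup>2 = 2 * real N * (a\<^sup>2 * P)"
    unfolding norm_stack y2 P_def ..
  also have "\<dots> = D\<^sup>2"
    using \<open>P > 0\<close> N by (simp add: a_def power_divide)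
  finally have "norm (stack y) = D" using assms(4) by simp

  have "in_F_SC L\<^sub>f \<mu>\<^sub>f \<kappa>\<^sub>A D f indicator_zero A 0 0"
    unfolding in_F_SC_def opt
    using smooth_f0[OF assms(1,2)] strongly_convex_f0[OF assms(2)]
      proper_closed_convex_indicator_zero condition_number_consensus_matrix[OF blk brow N, where 'd='d]
      N\<kappa> \<open>norm (stack y) = D\<close>
    by (auto simp: f_def)
  moreover have "norm (X k - stack y) \<ge> 1 / 2 * q powr (2 * real k / real N) * norm (X 0 - stack y)"
    if X: "linear_span_iterates f A 0 X" for X
  proof -
    define S where "S = (\<Sum>j = 1..K. (profile q d j)\<^sup>2)"
    define T where "T = (\<Sum>j = K + 1..d. (profile q d j)\<^sup>2)"
    have ST: "P = S + T"
      unfolding P_def S_def T_def using sum.ub_add_nat[of 1 K "\<lambda>j. (profile q d j)\<^sup>2" K]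
      by (simp add: assms(10) mult_2)
    have tail: "q ^ (2 * K) * S \<le> T"
      using profile_tail_ge[OF q(1,2), of K] by (simp add: S_def T_def assms(10))
    have "T \<ge> 0" unfolding T_def by (simp add: sum_nonneg)
    then have "q ^ (2 * K) * T \<le> T"
      using q by (intro mult_left_le_one_le) (auto intro: power_le_one)
    \<comment> \<open>Both halves of \<open>P\<close>, scaled by \<open>q ^ (2 * K)\<close>, are at
      most \<open>T\<close>.\<close>
    with tail have PT: "q ^ (2 * K) * P \<le> 2 * T" by (simp add: ST distrib_left)
    \<comment> \<open>The factor \<open>1 / 4\<close> from squaring pays for two halvings: only
      \<open>N\<close> of the \<open>2 * N\<close> blocks are counted, and \<open>T\<close> is
      compared with half of the scaled \<open>P\<close>.\<close>
    have "(1 / 2 * q ^ K * norm (stack y))\<^sup>2 = real N * a\<^sup>2 / 2 * (q ^ (2 * K) * P)"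
      unfolding power_mult_distrib nrm power_even_eq by (simp add: power2_eq_square)
    also have "\<dots> \<le> real N * a\<^sup>2 / 2 * (2 * T)"
      using PT by (intro mult_left_mono) auto
    also have "\<dots> = real N * (\<Sum>j = K + 1..d. (y j)\<^sup>2)"
      unfolding y2 T_def by simp
    also have "\<dots> \<le> (norm (X k - stack y))\<^sup>2"
      using X kK unfolding f_def by (rule norm_iterate_minus_stack_ge) (simp add: assms(10))
    finally have "1 / 2 * q ^ K * norm (stack y) \<le> norm (X k - stack y)"
      by (rule power2_le_imp_le) simp
    moreover have "q powr (2 * real k / real N) \<le> q ^ K"
      using powr_mono'[OF Kk, of q] q by (simp add: powr_realpow)
    then have "1 / 2 * q powr (2 * real k / real N) * norm (stack y) \<le> 1 / 2 * q ^ K * norm (stack y)"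
      by (intro mult_right_mono mult_left_mono) auto
    moreover have "X 0 = 0" using X by (simp add: linear_span_iterates_def)
    ultimately show ?thesis by simp
  qed
  ultimately show ?thesis
    using \<open>\<alpha> > 0\<close> unfolding Let_def q_def[symmetric]
    by (intro exI[of _ \<alpha>]) (simp add: opt[unfolded f_def] f_def)
qed

end
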